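(* Let $p,q\in\mathbb{R}$. The equation $x^3+px+q=0$ has three distinct real roots if and only if $\Delta=-\left(\frac{q^2}{4}+\frac{p^3}{27}\right)>0$. *)

theory Defs
  imports Complex_Main
begin

end

theory Submission
  imports Defs
begin

text \<open>If the roots are \<open>a\<close>, \<open>b\<close>, \<open>c\<close>, then \<open>108 * \<Delta> = ((a - b) * (b - c) * (c - a))\<^sup>2\<close>, which is positive
  for distinct roots. Conversely, take any real root \<open>a\<close> and split off \<open>x - a\<close>. Then
  \<open>108 * \<Delta> = (- 3 * a\<^sup>2 - 4 * p) * (3 * a\<^sup>2 + p)\<^sup>2\<close>, where the first factor is the discriminant of the
  quadratic cofactor and \<open>3 * a\<^sup>2 + p\<close> is its value at \<open>a\<close>. So if \<open>\<Delta> > 0\<close>, the cofactor has two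
  distinct real roots, both different from \<open>a\<close>.\<close>

text \<open>Intermediate value theorem on \<open>{- M..M}\<close>: since \<open>M\<close> is at
  least 1 and exceeds \<open>\<bar>p\<bar> + \<bar>q\<bar>\<close>, the cubic term dominates at both
  ends and fixes the signs there.\<close>

lemma depressed_cubic_root_exists:
  fixes p q :: real
  obtains a where "a ^ 3 + p * a + q = 0"
proof -
  define M where "M = 1 + \<bar>p\<bar> + \<bar>q\<bar>"
  have M1: "1 \<le> M" by (simp add: M_def)
  have "\<bar>q\<bar> * 1 \<le> \<bar>q\<bar> * M" using M1 by (intro mult_left_mono) auto
  then have "\<bar>p\<bar> * M + \<bar>q\<bar> \<le> M * M" using M1 by (simp add: M_def algebra_simps)
  also have "\<dots> \<le> M * M * M" using mult_left_mono[OF M1, of "M * M"] by simp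
  finally have bound: "\<bar>p\<bar> * M + \<bar>q\<bar> \<le> M ^ 3" by (simp add: power3_eq_cube)
  have "\<bar>p * M\<bar> = \<bar>p\<bar> * M" using M1 by (simp add: abs_mult)
  then have "(- M) ^ 3 + p * (- M) + q \<le> 0" "0 \<le> M ^ 3 + p * M + q"
    using bound by (simp_all add: abs_if split: if_splits)
  moreover have "continuous_on {- M..M} (\<lambda>x. x ^ 3 + p * x + q)"
    by (intro continuous_intros)
  ultimately obtain a where "a ^ 3 + p * a + q = 0"
    using IVT'[of "\<lambda>x. x ^ 3 + p * x + q" "- M" 0 M] M1 by auto
  then show thesis by (rule that)
qed

text \<open>Subtracting two equations leaves a multiple of the difference of the roots, which
  cancels. The right-hand sides contain only \<open>a\<close> and \<open>b\<close>, so the results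
  can eliminate \<open>c\<close>, \<open>p\<close> and \<open>q\<close> by rewriting.\<close>

lemma depressed_cubic_vieta:
  fixes a b c p q :: "'a :: idom"
  assumes "a ^ 3 + p * a + q = 0" "b ^ 3 + p * b + q = 0" "c ^ 3 + p * c + q = 0"
    and "a \<noteq> b" "a \<noteq> c" "b \<noteq> c"
  shows "c = - a - b" "p = - (a ^ 2 + a * b + b ^ 2)" "q = a * b * (a + b)"
proof -
  have "(a - b) * (a ^ 2 + a * b + b ^ 2 + p) = 0" using assms(1,2) by algebra
  then have ab: "a ^ 2 + a * b + b ^ 2 + p = 0" using \<open>a \<noteq> b\<close> by simp
  have "(a - c) * (a ^ 2 + a * c + c ^ 2 + p) = 0" using assms(1,3) by algebra
  then have "a ^ 2 + a * c + c ^ 2 + p = 0" using \<open>a \<noteq> c\<close> by simp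
  with ab have "(b - c) * (a + b + c) = 0" by algebra
  then have "a + b + c = 0" using \<open>b \<noteq> c\<close> by simp
  then show "c = - a - b" by algebra
  show p: "p = - (a ^ 2 + a * b + b ^ 2)" using ab by algebra
  show "q = a * b * (a + b)" using assms(1) p by algebra
qed

theorem corollary1:
  fixes p q :: real
  shows "card {x :: real. x ^ 3 + p * x + q = 0} = 3 \<longleftrightarrow>
    - (q ^ 2 / 4 + p ^ 3 / 27) > 0"
proof
  assume "card {x :: real. x ^ 3 + p * x + q = 0} = 3"
  then obtain a b c where S: "{x. x ^ 3 + p * x + q = 0} = {a, b, c}"
    and ne: "a \<noteq> b" "b \<noteq> c" "a \<noteq> c"
    unfolding card_3_iff by blast
  have "a ^ 3 + p * a + q = 0" "b ^ 3 + p * b + q = 0" "c ^ 3 + p * c + q = 0"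
    using S by blast+
  note v = depressed_cubic_vieta[OF this ne(1,3,2)]
  have "- 27 * q ^ 2 - 4 * p ^ 3 = ((a - b) * (b - c) * (c - a)) ^ 2"
    unfolding v by algebra
  moreover have "\<dots> > 0" using ne by simp
  ultimately show "- (q ^ 2 / 4 + p ^ 3 / 27) > 0" by linarith
next
  assume pos: "- (q ^ 2 / 4 + p ^ 3 / 27) > 0"
  obtain a where a: "a ^ 3 + p * a + q = 0" by (rule depressed_cubic_root_exists)
  define D where "D = - 3 * a ^ 2 - 4 * p"
  have "- 27 * q ^ 2 - 4 * p ^ 3 = D * (3 * a ^ 2 + p) ^ 2"
    using a unfolding D_def by algebra
  with pos have "D * (3 * a ^ 2 + p) ^ 2 > 0" by simp
  then have D: "D > 0" and a': "3 * a ^ 2 + p \<noteq> 0"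
    by (auto simp: zero_less_mult_iff)
  \<comment> \<open>The quadratic formula for the cofactor
    \<open>x ^ 2 + a * x + (a ^ 2 + p)\<close>.\<close>
  define b where "b = (- a + sqrt D) / 2"
  define c where "c = (- a - sqrt D) / 2"
  have sum: "b + c = - a" by (simp add: b_def c_def field_simps)
  have "4 * (b * c) = a ^ 2 - (sqrt D) ^ 2"
    by (simp add: b_def c_def field_simps power2_eq_square)
  also have "\<dots> = 4 * (a ^ 2 + p)" using D by (simp add: D_def)
  finally have prod: "b * c = a ^ 2 + p" by simp
  have "x ^ 3 + p * x + q = (x - a) * ((x - b) * (x - c))" for x
    using a sum prod by algebra
  then have "{x. x ^ 3 + p * x + q = 0} = {a, b, c}" by auto
  moreover have "b \<noteq> c" using D by (simp add: b_def c_def)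
  \<comment> \<open>This product is the cofactor evaluated at \<open>a\<close>, so one inequality
    separates \<open>a\<close> from both \<open>b\<close> and \<open>c\<close>.\<close>
  moreover have "(a - b) * (a - c) \<noteq> 0"
  proof -
    have "(a - b) * (a - c) = 3 * a ^ 2 + p" using sum prod by algebra
    with a' show ?thesis by simp
  qed
  ultimately show "card {x. x ^ 3 + p * x + q = 0} = 3" by auto
qed

end
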